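(* Let $f(t)=-\ln(t)$. Let $\rho_{AB}$ and $\sigma_{AB}$ be strictly positive matrices on a composite system $AB$ (i.e. on $\mathcal{H}_A\otimes\mathcal{H}_B$), and let $\rho_A=\mathrm{Tr}_B(\rho_{AB})$, $\sigma_A=\mathrm{Tr}_B(\sigma_{AB})$. Then equality in $$S_f(\rho_{AB}\,||\,\sigma_{AB})\ \geq\ S_f(\rho_A\,||\,\sigma_A)$$ holds if and only if $$\mathrm{Tr}\left(\sigma_{AB}^{\imath t}\,\rho_{AB}^{-\imath t+1}\right)=\mathrm{Tr}\left(\sigma_A^{\imath t}\,\rho_A^{-\imath t+1}\right)\qquad\text{for all } t\in\mathbb{C},$$ where $\imath=\sqrt{-1}$.
   Context: All Hilbert spaces are finite-dimensional and complex. "Strictly positive" means Hermitian positive definite; no trace normalization is assumed. For strictly positive $X$ and $z\in\mathbb{C}$, $X^z=\exp(z\ln X)$. Quantum $f$-relative entropy: for strictly positive $\rho,\sigma$ on the same $d$-dimensional space, $$S_f(\rho||\sigma)=\mathrm{vec}(\sqrt{\rho})^\dagger f\left[\sigma\otimes(\rho^{-1})^{\mathsf T}\right]\mathrm{vec}(\sqrt{\rho})=\sum_{i,j=1}^d p_i f\left(\frac{q_j}{p_i}\right)|\langle i_\rho|j_\sigma\rangle|^2,$$ where $\rho=\sum_i p_i|i_\rho\rangle\langle i_\rho|$ and $\sigma=\sum_j q_j|j_\sigma\rangle\langle j_\sigma|$ are spectral decompositions and $\mathrm{vec}(A)$ stacks the entries of $A$ row by row. For $f=-\ln$ this equals $\mathrm{Tr}\{\rho[\ln\rho-\ln\sigma]\}$.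 *)

theory Defs
  imports "HOL-Analysis.Analysis"
begin

definition adj :: "complex^'n^'m \<Rightarrow> complex^'m^'n" where
  "adj A = (\<chi> i j. cnj (A $ j $ i))"

definition cscale :: "complex \<Rightarrow> complex^'n^'m \<Rightarrow> complex^'n^'m" where
  "cscale c A = (\<chi> i j. c * A $ i $ j)"

definition cdot :: "complex^'n \<Rightarrow> complex^'n \<Rightarrow> complex" where
  "cdot x y = (\<Sum>i\<in>UNIV. cnj (x $ i) * y $ i)"

definition unitary_mat :: "complex^'n^'n \<Rightarrow> bool" where
  "unitary_mat U \<longleftrightarrow> adj U ** U = mat 1 \<and> U ** adj U = mat 1"

definition diag_mat :: "('n \<Rightarrow> complex) \<Rightarrow> complex^'n^'n" where
  "diag_mat d = (\<chi> i j. if i = j then d i else 0)"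

text \<open>The quadratic form of a Hermitian matrix is real, so \<open>Re\<close> loses nothing here.\<close>

definition strictly_positive :: "complex^'n^'n \<Rightarrow> bool" where
  "strictly_positive A \<longleftrightarrow> adj A = A \<and> (\<forall>x. x \<noteq> 0 \<longrightarrow> 0 < Re (cdot x (A *v x)))"

text \<open>
  Functional calculus: \<open>f(H) = U f(D) U\<^sup>\<dagger>\<close> for any unitary diagonalization \<open>H = U D U\<^sup>\<dagger>\<close> with
  real \<open>D\<close>. Lemma \<open>mat_fun_diag\<close> below shows that the result does not depend on the
  diagonalization. The value is meaningful only for Hermitian \<open>H\<close>.
\<close>

definition mat_fun :: "(real \<Rightarrow> real) \<Rightarrow> complex^'n^'n \<Rightarrow> complex^'n^'n" where
  "mat_fun f H = (THE M. \<exists>U d. unitary_mat U \<and>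
      H = U ** diag_mat (\<lambda>i. complex_of_real (d i)) ** adj U \<and>
      M = U ** diag_mat (\<lambda>i. complex_of_real (f (d i))) ** adj U)"

text \<open>
  The library's \<open>exp\<close> and powers cannot be used on \<^typ>\<open>complex^'n^'n\<close>: multiplication on that type
  is componentwise. The matrix product is \<open>**\<close>.
\<close>

primrec mat_power :: "complex^'n^'n \<Rightarrow> nat \<Rightarrow> complex^'n^'n" where
  "mat_power A 0 = mat 1"
| "mat_power A (Suc k) = A ** mat_power A k"

definition mat_exp :: "complex^'n^'n \<Rightarrow> complex^'n^'n" where
  "mat_exp A = (\<Sum>k. mat_power A k /\<^sub>R fact k)"

definition mat_cpow :: "complex^'n^'n \<Rightarrow> complex \<Rightarrow> complex^'n^'n" where
  "mat_cpow X z = mat_exp (cscale z (mat_fun ln X))"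

definition kron :: "complex^'n^'n \<Rightarrow> complex^'m^'m \<Rightarrow> complex^('n \<times> 'm)^('n \<times> 'm)" where
  "kron A B = (\<chi> p q. A $ fst p $ fst q * B $ snd p $ snd q)"

text \<open>The index \<open>(i, j)\<close> is (row, column): reading pairs lexicographically stacks \<open>A\<close> row by row,
  so that \<open>kron A (transpose B)\<close> sends the vectorization of \<open>X\<close> to that of \<open>A ** X ** B\<close>.\<close>

definition vec_rows :: "complex^'n^'n \<Rightarrow> complex^('n \<times> 'n)" where
  "vec_rows A = (\<chi> p. A $ fst p $ snd p)"

definition f_rel_entropy :: "(real \<Rightarrow> real) \<Rightarrow> complex^'n^'n \<Rightarrow> complex^'n^'n \<Rightarrow> complex" where
  "f_rel_entropy f \<rho> \<sigma> =
     cdot (vec_rows (mat_fun sqrt \<rho>))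
          (mat_fun f (kron \<sigma> (transpose (matrix_inv \<rho>))) *v vec_rows (mat_fun sqrt \<rho>))"

text \<open>A matrix on the composite system is indexed by \<^typ>\<open>'a \<times> 'b\<close>, with \<^typ>\<open>'a\<close> and \<^typ>\<open>'b\<close>
  indexing orthonormal bases of the two factors.\<close>

definition ptrace_B :: "complex^('a::finite \<times> 'b::finite)^('a \<times> 'b) \<Rightarrow> complex^'a^'a" where
  "ptrace_B X = (\<chi> i j. \<Sum>k\<in>UNIV. X $ (i, k) $ (j, k))"


subsection \<open>Independence of the diagonalization, and closed forms\<close>

lemma adj_mult: "adj (A ** B) = adj B ** adj A"
  by (simp add: adj_def matrix_matrix_mult_def vec_eq_iff mult.commute)

lemma adj_adj [simp]: "adj (adj A) = A"
  by (simp add: adj_def vec_eq_iff)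

lemma mat_diag_mult: "(A ** diag_mat d) $ i $ j = A $ i $ j * d j"
  by (simp add: matrix_matrix_mult_def diag_mat_def if_distrib cong: if_cong)

lemma diag_mat_mult: "(diag_mat d ** A) $ i $ j = d i * A $ i $ j"
  by (simp add: matrix_matrix_mult_def diag_mat_def if_distrib[where f="\<lambda>x. x * _"] cong: if_cong)

lemma diag_mat_vec: "(diag_mat d *v x) $ i = d i * x $ i"
  by (simp add: matrix_vector_mult_def diag_mat_def if_distrib[where f="\<lambda>x. x * _"] cong: if_cong)

lemma unitary_conj_eq_iff:
  assumes "unitary_mat U" "unitary_mat V"
  shows "U ** A ** adj U = V ** B ** adj V \<longleftrightarrow> (adj V ** U) ** A = B ** (adj V ** U)"
proof
  assume *: "U ** A ** adj U = V ** B ** adj V"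
  have "adj V ** (U ** A ** adj U) ** U = adj V ** U ** A ** (adj U ** U)"
    by (simp add: matrix_mul_assoc)
  moreover have "adj V ** (V ** B ** adj V) ** U = (adj V ** V) ** B ** (adj V ** U)"
    by (simp add: matrix_mul_assoc)
  ultimately show "(adj V ** U) ** A = B ** (adj V ** U)"
    using assms * by (simp add: unitary_mat_def)
next
  assume *: "(adj V ** U) ** A = B ** (adj V ** U)"
  have "V ** ((adj V ** U) ** A) ** adj U = (V ** adj V) ** U ** A ** adj U"
    by (simp add: matrix_mul_assoc)
  moreover have "V ** (B ** (adj V ** U)) ** adj U = V ** B ** adj V ** (U ** adj U)"
    by (simp add: matrix_mul_assoc)
  ultimately show "U ** A ** adj U = V ** B ** adj V"
    using assms * by (simp add: unitary_mat_def)
qed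

lemma mat_fun_diag:
  assumes "unitary_mat U"
  shows "mat_fun f (U ** diag_mat (\<lambda>i. complex_of_real (d i)) ** adj U)
       = U ** diag_mat (\<lambda>i. complex_of_real (f (d i))) ** adj U"
  unfolding mat_fun_def
proof (rule the_equality)
  fix M assume "\<exists>V e. unitary_mat V \<and>
      U ** diag_mat (\<lambda>i. complex_of_real (d i)) ** adj U
        = V ** diag_mat (\<lambda>i. complex_of_real (e i)) ** adj V \<and>
      M = V ** diag_mat (\<lambda>i. complex_of_real (f (e i))) ** adj V"
  then obtain V e where V: "unitary_mat V"
    and eq: "U ** diag_mat (\<lambda>i. complex_of_real (d i)) ** adj U
        = V ** diag_mat (\<lambda>i. complex_of_real (e i)) ** adj V"
    and M: "M = V ** diag_mat (\<lambda>i. complex_of_real (f (e i))) ** adj V" by blast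
  define W where "W = adj V ** U"
  have W: "W ** diag_mat (\<lambda>i. complex_of_real (d i)) = diag_mat (\<lambda>i. complex_of_real (e i)) ** W"
    using eq unfolding unitary_conj_eq_iff[OF assms V] W_def .
  have "W $ i $ j * complex_of_real (d j) = complex_of_real (e i) * W $ i $ j" for i j
    using arg_cong[OF W, of "\<lambda>X. X $ i $ j"] by (simp add: mat_diag_mult diag_mat_mult)
  then have "W $ i $ j = 0 \<or> d j = e i" for i j
    by (metis mult.commute mult_cancel_left of_real_eq_iff)
  then have "W $ i $ j * complex_of_real (f (d j)) = complex_of_real (f (e i)) * W $ i $ j" for i j
    by (metis mult.commute mult_eq_0_iff)
  then have "W ** diag_mat (\<lambda>i. complex_of_real (f (d i)))
           = diag_mat (\<lambda>i. complex_of_real (f (e i))) ** W"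
    by (simp add: vec_eq_iff mat_diag_mult diag_mat_mult)
  then show "M = U ** diag_mat (\<lambda>i. complex_of_real (f (d i))) ** adj U"
    unfolding M W_def using unitary_conj_eq_iff[OF assms V] by metis
qed (use assms in blast)

lemma conj_diag_nth:
  "(U ** diag_mat d ** adj U) $ i $ j = (\<Sum>k\<in>UNIV. U $ i $ k * d k * cnj (U $ j $ k))"
  by (subst matrix_matrix_mult_def) (simp add: mat_diag_mult adj_def)

lemma mat_power_diag:
  assumes "unitary_mat U"
  shows "mat_power (U ** diag_mat d ** adj U) k = U ** diag_mat (\<lambda>i. d i ^ k) ** adj U"
proof (induction k)
  case 0
  have "diag_mat (\<lambda>i. 1) = (mat 1 :: complex^'a^'a)"
    by (simp add: diag_mat_def mat_def)
  then show ?case using assms by (simp add: unitary_mat_def)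
next
  case (Suc k)
  have "mat_power (U ** diag_mat d ** adj U) (Suc k)
      = U ** diag_mat d ** (adj U ** U) ** diag_mat (\<lambda>i. d i ^ k) ** adj U"
    by (simp add: Suc matrix_mul_assoc)
  also have "\<dots> = U ** (diag_mat d ** diag_mat (\<lambda>i. d i ^ k)) ** adj U"
    using assms by (simp add: unitary_mat_def matrix_mul_assoc)
  also have "diag_mat d ** diag_mat (\<lambda>i. d i ^ k) = diag_mat (\<lambda>i. d i ^ Suc k)"
    by (simp add: vec_eq_iff diag_mat_mult) (simp add: diag_mat_def)
  finally show ?case .
qed

lemma mat_exp_diag:
  assumes "unitary_mat U"
  shows "mat_exp (U ** diag_mat d ** adj U) = U ** diag_mat (\<lambda>i. exp (d i)) ** adj U"
proof -
  have "(\<lambda>k. U $ i $ l * (d l ^ k /\<^sub>R fact k) * cnj (U $ j $ l))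
          sums (U $ i $ l * exp (d l) * cnj (U $ j $ l))" for i j l
    by (intro sums_mult sums_mult2 exp_converges)
  then have "(\<lambda>k. \<Sum>l\<in>UNIV. U $ i $ l * (d l ^ k /\<^sub>R fact k) * cnj (U $ j $ l))
          sums (U ** diag_mat (\<lambda>i. exp (d i)) ** adj U) $ i $ j" for i j
    unfolding conj_diag_nth by (intro sums_sum)
  then have "(\<lambda>k. (mat_power (U ** diag_mat d ** adj U) k /\<^sub>R fact k) $ i $ j)
          sums (U ** diag_mat (\<lambda>i. exp (d i)) ** adj U) $ i $ j" for i j
    by (simp add: mat_power_diag[OF assms] conj_diag_nth scaleR_sum_right)
  then have "(\<lambda>k. mat_power (U ** diag_mat d ** adj U) k /\<^sub>R fact k)
          sums (U ** diag_mat (\<lambda>i. exp (d i)) ** adj U)"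
    unfolding sums_def by (intro vec_tendstoI) simp
  then show ?thesis
    unfolding mat_exp_def by (rule sums_unique[symmetric])
qed

lemma mat_cpow_diag:
  assumes "unitary_mat U" "\<And>i. 0 < p i"
  shows "mat_cpow (U ** diag_mat (\<lambda>i. complex_of_real (p i)) ** adj U) z
       = U ** diag_mat (\<lambda>i. complex_of_real (p i) powr z) ** adj U"
proof -
  have "cscale z (U ** diag_mat (\<lambda>i. complex_of_real (ln (p i))) ** adj U)
      = U ** diag_mat (\<lambda>i. z * complex_of_real (ln (p i))) ** adj U"
    by (simp add: vec_eq_iff cscale_def conj_diag_nth sum_distrib_left mult_ac)
  moreover have "exp (z * complex_of_real (ln (p i))) = complex_of_real (p i) powr z" for i
    using assms(2)[of i] by (simp add: powr_def Ln_of_real)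
  ultimately show ?thesis
    by (simp add: mat_cpow_def mat_fun_diag[OF assms(1)] mat_exp_diag[OF assms(1)])
qed

lemma unitary_mat_kron:
  assumes "unitary_mat U" "unitary_mat V"
  shows "unitary_mat (kron U V)"
proof -
  have mult: "kron A B ** kron C D = kron (A ** C) (B ** D)"
    for A C :: "complex^'a^'a" and B D :: "complex^'b^'b"
    by (simp add: vec_eq_iff kron_def matrix_matrix_mult_def sum_product UNIV_Times_UNIV[symmetric]
        sum.cartesian_product mult_ac del: UNIV_Times_UNIV) (simp add: case_prod_unfold)
  have "kron (mat 1) (mat 1) = (mat 1 :: complex^('a \<times> 'b)^('a \<times> 'b))"
    by (auto simp: vec_eq_iff kron_def mat_def)
  moreover have "adj (kron U V) = kron (adj U) (adj V)"
    by (simp add: vec_eq_iff kron_def adj_def)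
  ultimately show ?thesis
    using assms by (simp add: unitary_mat_def mult)
qed

lemma matrix_inv_unique:
  fixes A B :: "complex^'n^'n"
  assumes "A ** B = mat 1" "B ** A = mat 1"
  shows "matrix_inv A = B"
proof -
  have "A ** matrix_inv A = mat 1"
    unfolding matrix_inv_def by (rule someI2[of _ B]) (use assms in auto)
  then show ?thesis
    by (metis assms(2) matrix_mul_assoc matrix_mul_lid matrix_mul_rid)
qed

text \<open>In the next lemma, \<open>(adj V ** U) $ j $ i\<close> is the overlap of the \<open>j\<close>-th eigenvector of \<open>\<sigma>\<close>
  with the \<open>i\<close>-th eigenvector of \<open>\<rho>\<close>. In particular the relative entropy is real.\<close>

lemma f_rel_entropy_spectral:
  fixes U V :: "complex^'n^'n"
  assumes U: "unitary_mat U" and V: "unitary_mat V" and p: "\<And>i. 0 < p i"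
  shows "f_rel_entropy f (U ** diag_mat (\<lambda>i. complex_of_real (p i)) ** adj U)
                         (V ** diag_mat (\<lambda>j. complex_of_real (q j)) ** adj V)
       = complex_of_real (\<Sum>i\<in>UNIV. \<Sum>j\<in>UNIV. p i * f (q j / p i) * (cmod ((adj V ** U) $ j $ i))\<^sup>2)"
    (is "f_rel_entropy f ?\<rho> ?\<sigma> = _")
proof -
  define W where "W = kron V (\<chi> i j. cnj (U $ i $ j))"
  have cU: "unitary_mat (\<chi> i j. cnj (U $ i $ j))" (is "unitary_mat ?C")
  proof -
    have "adj ?C ** ?C = (\<chi> i j. cnj ((adj U ** U) $ i $ j))"
         "?C ** adj ?C = (\<chi> i j. cnj ((U ** adj U) $ i $ j))"
      by (simp_all add: vec_eq_iff matrix_matrix_mult_def adj_def)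
    then show ?thesis using U by (simp add: unitary_mat_def mat_def vec_eq_iff)
  qed
  have W: "unitary_mat W" unfolding W_def by (rule unitary_mat_kron[OF V cU])
  have inv: "matrix_inv ?\<rho> = U ** diag_mat (\<lambda>i. complex_of_real (1 / p i)) ** adj U"
  proof (rule matrix_inv_unique)
    have *: "U ** diag_mat a ** adj U ** (U ** diag_mat b ** adj U) = mat 1"
      if "\<And>i. a i * b i = 1" for a b
    proof -
      have "diag_mat a ** diag_mat b = (mat 1 :: complex^'n^'n)"
        using that by (simp add: vec_eq_iff diag_mat_mult) (simp add: diag_mat_def mat_def)
      moreover have "U ** diag_mat a ** adj U ** (U ** diag_mat b ** adj U)
          = U ** diag_mat a ** (adj U ** U) ** diag_mat b ** adj U"
        by (simp add: matrix_mul_assoc)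
      ultimately show ?thesis using U
        by (metis matrix_mul_assoc matrix_mul_rid unitary_mat_def)
    qed
    have p': "p i \<noteq> 0" for i using p[of i] by simp
    show "?\<rho> ** (U ** diag_mat (\<lambda>i. complex_of_real (1 / p i)) ** adj U) = mat 1"
      by (rule *) (use p' in simp)
    show "(U ** diag_mat (\<lambda>i. complex_of_real (1 / p i)) ** adj U) ** ?\<rho> = mat 1"
      by (rule *) (use p' in simp)
  qed
  have kr: "kron ?\<sigma> (transpose (matrix_inv ?\<rho>))
      = W ** diag_mat (\<lambda>r. complex_of_real (q (fst r) / p (snd r))) ** adj W"
    unfolding inv
    by (simp add: vec_eq_iff conj_diag_nth kron_def W_def transpose_def sum_product
        UNIV_Times_UNIV[symmetric] sum.cartesian_product mult_ac del: UNIV_Times_UNIV)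
       (simp add: case_prod_unfold mult_ac)
  define v where "v = vec_rows (mat_fun sqrt ?\<rho>)"
  have mf: "mat_fun f (kron ?\<sigma> (transpose (matrix_inv ?\<rho>)))
      = W ** diag_mat (\<lambda>r. complex_of_real (f (q (fst r) / p (snd r)))) ** adj W"
    unfolding kr by (rule mat_fun_diag[OF W])
  have adjv: "cdot v (A *v x) = cdot (adj A *v v) x" for A x
    unfolding cdot_def matrix_vector_mult_def adj_def
    by (simp add: sum_distrib_left sum_distrib_right mult_ac) (rule sum.swap)
  have Wv: "(adj W *v v) $ (j, i) = (adj V ** U) $ j $ i * complex_of_real (sqrt (p i))" for i j
  proof -
    let ?S = "U ** diag_mat (\<lambda>i. complex_of_real (sqrt (p i))) ** adj U"
    have "(adj W *v v) $ (j, i) = (\<Sum>r\<in>UNIV \<times> UNIV. cnj (V $ fst r $ j) * U $ snd r $ i * ?S $ fst r $ snd r)"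
      unfolding v_def mat_fun_diag[OF U] W_def matrix_vector_mult_def
      by (simp add: vec_rows_def kron_def adj_def[of "\<chi> p q. _ p q"])
    also have "\<dots> = (\<Sum>b\<in>UNIV. \<Sum>a\<in>UNIV. cnj (V $ a $ j) * U $ b $ i * ?S $ a $ b)"
      by (subst sum.swap) (simp only: sum.cartesian_product case_prod_unfold)
    also have "\<dots> = (adj V ** ?S ** U) $ j $ i"
      unfolding matrix_matrix_mult_def[of _ U] matrix_matrix_mult_def[of "adj V"]
      by (simp add: adj_def[of V] sum_distrib_left mult_ac)
    also have "adj V ** (U ** diag_mat (\<lambda>i. complex_of_real (sqrt (p i))) ** adj U) ** U
        = adj V ** U ** diag_mat (\<lambda>i. complex_of_real (sqrt (p i))) ** (adj U ** U)"
      by (simp add: matrix_mul_assoc)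
    finally show ?thesis using U by (simp add: unitary_mat_def mat_diag_mult)
  qed
  have "f_rel_entropy f ?\<rho> ?\<sigma>
     = cdot (adj W *v v) (diag_mat (\<lambda>r. complex_of_real (f (q (fst r) / p (snd r)))) *v (adj W *v v))"
    unfolding f_rel_entropy_def mf v_def[symmetric]
    by (simp add: adjv matrix_vector_mul_assoc[symmetric])
  also have "\<dots> = (\<Sum>r\<in>UNIV. complex_of_real (f (q (fst r) / p (snd r)))
      * complex_of_real ((cmod ((adj W *v v) $ r))\<^sup>2))"
    unfolding cdot_def complex_norm_square
    by (simp add: diag_mat_vec mult_ac)
  also have "\<dots> = (\<Sum>j\<in>UNIV. \<Sum>i\<in>UNIV. complex_of_real (p i * f (q j / p i) * (cmod ((adj V ** U) $ j $ i))\<^sup>2))"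
    unfolding UNIV_Times_UNIV[symmetric] sum.cartesian_product
    by (rule sum.cong)
       (use p in \<open>auto simp: Wv norm_mult power_mult_distrib less_imp_le mult_ac
          of_real_power[symmetric] simp del: of_real_power\<close>)
  also have "\<dots> = complex_of_real (\<Sum>i\<in>UNIV. \<Sum>j\<in>UNIV. p i * f (q j / p i) * (cmod ((adj V ** U) $ j $ i))\<^sup>2)"
    by (subst sum.swap) simp
  finally show ?thesis .
qed

end

theory Submission
  imports Defs "HOL-Real_Asymp.Real_Asymp"
begin

text \<open>
  Let \<open>\<mu>\<close> be the measure with mass \<open>p\<^sub>i |\<langle>i\<^sub>\<rho>|j\<^sub>\<sigma>\<rangle>|\<^sup>2\<close> at \<open>q\<^sub>j / p\<^sub>i\<close>; both the relative entropy and the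
  traces are integrals against \<open>\<mu>\<close>. For \<open>s > 0\<close>, \<open>\<integral> d\<mu>(x) / (x + s)\<close> is the maximum over \<open>X\<close> of
  \<open>2 Re Tr (X\<^sup>* \<rho>) - Tr (X\<^sup>* \<sigma> X) - s Tr (X \<rho> X\<^sup>*)\<close>. Restricting to \<open>X = X\<^sub>A \<otimes> 1\<close> gives the same
  maximum for the reduced matrices, so the Stieltjes transform decreases under the partial trace.
  Integrating over \<open>s\<close>, equality of the entropies forces equality for every \<open>s\<close>, hence equality of
  the two measures and of all traces. Conversely, the entropy is, up to a constant factor, the
  derivative of the trace at \<open>t = 0\<close>.
\<close>

section \<open>Signed measures with nonnegative Stieltjes transform\<close>

text \<open>After equal nodes are merged, clearing denominators turns the transform into a
  polynomial that vanishes on the positive reals, hence identically. Each merged mass can then be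
  read off at the negative of its node. The test function \<open>h\<close> may take values in any
  real vector space, so that complex exponentials are covered.\<close>

lemma Stieltjes_transform_zero_imp_zero:
  fixes c x :: "'k \<Rightarrow> real" and h :: "real \<Rightarrow> 'v::real_vector"
  assumes K: "finite K" and x: "\<And>k. k \<in> K \<Longrightarrow> 0 < x k"
    and zero: "\<And>s. 0 < s \<Longrightarrow> (\<Sum>k\<in>K. c k / (x k + s)) = 0"
  shows "(\<Sum>k\<in>K. c k *\<^sub>R h (x k)) = 0"
proof -
  define L where "L = x ` K"
  define C where "C l = (\<Sum>k | k \<in> K \<and> x k = l. c k)" for l
  have L: "finite L" "\<And>l. l \<in> L \<Longrightarrow> 0 < l" using K x by (auto simp: L_def)
  have group: "(\<Sum>l\<in>L. C l *\<^sub>R g l) = (\<Sum>k\<in>K. c k *\<^sub>R g (x k))" for g :: "real \<Rightarrow> 'w::real_vector"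
    unfolding L_def C_def
    by (subst sum.image_gen[OF K, of _ x]) (simp add: scaleR_sum_left)
  define P where "P = (\<Sum>l\<in>L. Polynomial.smult (C l) (\<Prod>m\<in>L - {l}. [:m, 1:]))"
  have "poly P s = 0" if "0 < s" for s
  proof -
    have nz: "m + s \<noteq> 0" if "m \<in> L" for m using L(2)[OF that] \<open>0 < s\<close> by simp
    have "poly P s = (\<Sum>l\<in>L. C l * (\<Prod>m\<in>L - {l}. m + s))"
      by (simp add: P_def poly_sum poly_prod)
    also have "\<dots> = (\<Sum>l\<in>L. C l *\<^sub>R (1 / (l + s))) * (\<Prod>m\<in>L. m + s)"
      unfolding sum_distrib_right
      by (rule sum.cong) (use nz L(1) in \<open>auto simp: prod.remove\<close>)
    also have "\<dots> = 0" unfolding group using zero[OF that] by simp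
    finally show ?thesis .
  qed
  then have "{0<..} \<subseteq> {s. poly P s = 0}" by auto
  then have "infinite {s. poly P s = 0}" using infinite_Ioi[of "0::real"] finite_subset by blast
  then have "P = 0" using poly_roots_finite by blast
  \<comment> \<open>At \<open>- l\<close> every summand of \<open>P\<close> other than the one for
    \<open>l\<close> contains the factor \<open>m - l\<close> with \<open>m = l\<close>.\<close>
  have "C l = 0" if "l \<in> L" for l
  proof -
    have "0 = poly P (- l)" using \<open>P = 0\<close> by simp
    also have "\<dots> = (\<Sum>l'\<in>L. C l' * (\<Prod>m\<in>L - {l'}. m - l))"
      by (simp add: P_def poly_sum poly_prod)
    also have "\<dots> = C l * (\<Prod>m\<in>L - {l}. m - l)"
      by (subst sum.remove[OF L(1) that], subst sum.neutral) (use that L(1) in auto)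
    finally show ?thesis using L(1) by auto
  qed
  then show ?thesis using group[of h] by simp
qed

text \<open>The function \<open>s \<mapsto> \<Sum>k. c k * ln (x k + s)\<close> has the Stieltjes transform as derivative and
  vanishes both at \<open>0\<close> and at infinity.\<close>

lemma Stieltjes_transform_zero:
  fixes c x :: "'k \<Rightarrow> real"
  assumes K: "finite K" and x: "\<And>k. k \<in> K \<Longrightarrow> 0 < x k"
    and nonneg: "\<And>s. 0 < s \<Longrightarrow> 0 \<le> (\<Sum>k\<in>K. c k / (x k + s))"
    and sum: "(\<Sum>k\<in>K. c k) = 0" and ln: "(\<Sum>k\<in>K. c k * ln (x k)) = 0"
    and s: "0 < s"
  shows "(\<Sum>k\<in>K. c k / (x k + s)) = 0"
proof -
  define G where "G s = (\<Sum>k\<in>K. c k * ln (x k + s))" for s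
  have der: "(G has_real_derivative (\<Sum>k\<in>K. c k / (x k + s))) (at s)" if "0 \<le> s" for s
    unfolding G_def
    by (rule derivative_eq_intros refl | use x that in \<open>force simp: add_pos_nonneg\<close>)+
  have mono: "G a \<le> G b" if "0 \<le> a" "a \<le> b" for a b
  proof (rule DERIV_nonneg_imp_increasing_open[OF that(2)])
    show "\<exists>y. (G has_real_derivative y) (at t) \<and> 0 \<le> y" if "a < t" "t < b" for t
      using der[of t] nonneg[of t] \<open>0 \<le> a\<close> that by force
    show "continuous_on {a..b} G"
      by (rule DERIV_continuous_on, rule has_field_derivative_at_within, rule der)
        (use \<open>0 \<le> a\<close> in auto)
  qed
  \<comment> \<open>Since the masses \<open>c k\<close> sum to zero, subtracting \<open>ln s\<close>
    from every logarithm does not change \<open>G s\<close>, and each difference tends to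
    zero.\<close>
  have "((\<lambda>s. \<Sum>k\<in>K. c k * (ln (x k + s) - ln s)) \<longlongrightarrow> (\<Sum>k\<in>K. c k * 0)) at_top"
    by (intro tendsto_sum tendsto_mult tendsto_const) real_asymp
  then have lim: "(G \<longlongrightarrow> 0) at_top"
    using sum by (simp add: G_def[abs_def] right_diff_distrib sum_subtractf flip: sum_distrib_right)
  have "G 0 = 0" using ln by (simp add: G_def)
  \<comment> \<open>A nondecreasing function lies below its limit at infinity. Together with
    \<open>G 0 = 0\<close> this makes \<open>G\<close> constant, so its derivative vanishes.\<close>
  moreover have "G a \<le> 0" if "0 \<le> a" for a
  proof -
    have "\<forall>\<^sub>F b in at_top. G a \<le> G b"
      using eventually_ge_at_top[of a] by eventually_elim (rule mono[OF that])
    then show ?thesis using tendsto_lowerbound[OF lim] by simp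
  qed
  ultimately have G0: "G a = 0" if "0 \<le> a" for a
    using mono[of 0 a] that by fastforce
  have "(G has_real_derivative 0) (at s)"
    by (rule has_field_derivative_transform_within_open[of "\<lambda>_. 0" 0 s "{0<..}"]) (use s G0 in auto)
  then show ?thesis using DERIV_unique der[of s] s by fastforce
qed

section \<open>Diagonalization of strictly positive matrices\<close>

lemma cdot_adj: "cdot x (A *v y) = cdot (adj A *v x) y"
  unfolding cdot_def matrix_vector_mult_def adj_def
  by (simp add: sum_distrib_left sum_distrib_right mult_ac) (rule sum.swap)

lemma cdot_commute: "cdot y x = cnj (cdot x y)"
  by (simp add: cdot_def mult.commute)

lemma cdot_simps:
  "cdot x (y + z) = cdot x y + cdot x z" "cdot (x + y) z = cdot x z + cdot y z"
  "cdot x (y - z) = cdot x y - cdot x z" "cdot (x - y) z = cdot x z - cdot y z"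
  "cdot x (r *\<^sub>R y) = r *\<^sub>R cdot x y" "cdot (r *\<^sub>R x) y = r *\<^sub>R cdot x y"
  "cdot x 0 = 0"
  by (simp_all add: cdot_def sum.distrib sum_subtractf algebra_simps scaleR_sum_right)

lemma cdot_self: "cdot x x = complex_of_real ((norm x)\<^sup>2)"
  by (simp add: cdot_def norm_vec_def L2_set_def sum_nonneg complex_norm_square mult.commute
      del: of_real_power)

lemma complex_matrix_vector_mult_scaleR:
  fixes A :: "complex^'n^'m"
  shows "A *v (r *\<^sub>R x) = r *\<^sub>R (A *v x)"
  by (simp add: matrix_vector_mult_def vec_eq_iff scaleR_sum_right)

lemma continuous_on_cdot [continuous_intros]:
  assumes "continuous_on S f" "continuous_on S g"
  shows "continuous_on S (\<lambda>x. cdot (f x) (g x))"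
  unfolding cdot_def using assms by (intro continuous_intros)

lemma continuous_on_matrix_vector_mult [continuous_intros]:
  fixes A :: "complex^'n^'m"
  assumes "continuous_on S f"
  shows "continuous_on S (\<lambda>x. A *v f x)"
  unfolding matrix_vector_mult_def using assms by (intro continuous_intros)

text \<open>A maximizer of the Rayleigh quotient on an invariant orthogonal complement is an eigenvector.\<close>

lemma hermitian_eigenvector_orthogonal:
  fixes H :: "complex^'n^'n" and u :: "'k \<Rightarrow> complex^'n"
  assumes H: "adj H = H"
    and eig: "\<And>j. j \<in> J \<Longrightarrow> H *v u j = d j *\<^sub>R u j"
    and y: "y \<noteq> 0" "\<And>j. j \<in> J \<Longrightarrow> cdot (u j) y = 0"
  obtains x l where "norm x = 1" "\<And>j. j \<in> J \<Longrightarrow> cdot (u j) x = 0" "H *v x = l *\<^sub>R x"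
proof -
  define T where "T = {x. \<forall>j\<in>J. cdot (u j) x = 0}"
  have T_scale: "r *\<^sub>R x \<in> T" if "x \<in> T" for r x using that by (simp add: T_def cdot_simps)
  have T_diff: "x - z \<in> T" if "x \<in> T" "z \<in> T" for x z using that by (simp add: T_def cdot_simps)
  have T_H: "H *v x \<in> T" if "x \<in> T" for x
    using that eig H by (simp add: T_def cdot_adj cdot_simps)
  have "T = (\<Inter>j\<in>J. {x. cdot (u j) x = 0})" by (auto simp: T_def)
  moreover have "closed {x. cdot (u j) x = 0}" for j
    by (intro closed_Collect_eq continuous_intros)
  ultimately have "closed T" by auto
  then have comp: "compact (sphere 0 1 \<inter> T)" by (simp add: compact_Int_closed)
  have "(1 / norm y) *\<^sub>R y \<in> sphere 0 1 \<inter> T"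
    using y T_scale[of y] by (simp add: T_def)
  then have "sphere 0 1 \<inter> T \<noteq> {}" by blast
  moreover have "continuous_on (sphere 0 1 \<inter> T) (\<lambda>x. Re (cdot x (H *v x)))"
    by (intro continuous_intros)
  ultimately obtain x where x: "x \<in> sphere 0 1 \<inter> T"
    and max: "\<And>z. z \<in> sphere 0 1 \<inter> T \<Longrightarrow> Re (cdot z (H *v z)) \<le> Re (cdot x (H *v x))"
    using continuous_attains_sup[OF comp] by blast
  define l where "l = Re (cdot x (H *v x))"
  define B where "B z = l *\<^sub>R z - H *v z" for z
  have nx: "norm x = 1" and xT: "x \<in> T" using x by auto
  \<comment> \<open>Maximality of \<open>l\<close> on the unit sphere of \<open>T\<close> extends to
    all of \<open>T\<close> by scaling: \<open>B\<close> is positive semidefinite there.\<close>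
  have pos: "0 \<le> Re (cdot z (B z))" if "z \<in> T" for z
  proof (cases "z = 0")
    case False
    define r where "r = norm z"
    define e where "e = (1 / r) *\<^sub>R z"
    have r: "0 < r" and z: "z = r *\<^sub>R e" using False by (simp_all add: r_def e_def)
    have "e \<in> sphere 0 1 \<inter> T" using False that T_scale by (simp add: e_def r_def)
    then have e: "Re (cdot e (H *v e)) \<le> l" "norm e = 1" using max by (auto simp: l_def)
    have "cdot z (B z) = r *\<^sub>R r *\<^sub>R (l *\<^sub>R cdot e e - cdot e (H *v e))"
      by (simp add: z B_def cdot_simps complex_matrix_vector_mult_scaleR algebra_simps)
    then show ?thesis using e r by (simp add: cdot_self)
  qed (simp add: B_def cdot_simps)
  define b where "b = B x"
  have bT: "b \<in> T" unfolding b_def B_def by (intro T_diff T_scale T_H xT)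
  have B_self: "cdot z (B z') = cdot (B z) z'" for z z'
    by (simp add: B_def cdot_simps cdot_adj[of z] H)
  have Bx0: "Re (cdot x b) = 0" by (simp add: b_def B_def cdot_simps cdot_self nx l_def)
  \<comment> \<open>The form of \<open>B\<close> vanishes at \<open>x\<close>, so moving from
    \<open>x\<close> to \<open>x - t b\<close> changes it by \<open>-2 t |b|^2\<close> to first
    order. Nonnegativity as \<open>t\<close> tends to zero from the right forces
    \<open>b = 0\<close>.\<close>
  have key: "2 * (norm b)\<^sup>2 \<le> t * Re (cdot b (B b))" if "0 < t" for t
  proof -
    have "B (x - t *\<^sub>R b) = b - t *\<^sub>R B b"
      by (simp add: B_def b_def matrix_vector_mult_diff_distrib complex_matrix_vector_mult_scaleR algebra_simps)
    then have "0 \<le> Re (cdot (x - t *\<^sub>R b) (b - t *\<^sub>R B b))"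
      using pos[OF T_diff[OF xT T_scale[OF bT]], of t] by simp
    also have "\<dots> = t * (t * Re (cdot b (B b)) - 2 * (norm b)\<^sup>2)"
      using Bx0 by (simp add: cdot_simps B_self[of x] flip: b_def) (simp add: cdot_self algebra_simps)
    finally show ?thesis using that by (simp add: zero_le_mult_iff)
  qed
  have "((\<lambda>t. t * Re (cdot b (B b))) \<longlongrightarrow> 0 * Re (cdot b (B b))) (at_right 0)"
    by (intro tendsto_intros)
  then have "2 * (norm b)\<^sup>2 \<le> 0 * Re (cdot b (B b))"
    by (rule tendsto_lowerbound) (use key in \<open>auto simp: eventually_at_right_less eventually_at_filter\<close>)
  then have "b = 0" by simp
  then have "H *v x = l *\<^sub>R x" by (simp add: b_def B_def)
  then show thesis using that nx xT by (auto simp: T_def)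
qed

text \<open>The conjugated vectors for indices in \<open>J\<close> serve as rows of a square matrix
  whose other rows are zero. At least one row is zero, so the matrix is singular, and a kernel
  vector is the required \<open>y\<close>.\<close>

lemma exists_orthogonal_nonzero:
  fixes u :: "'n \<Rightarrow> complex^'n"
  assumes "J \<noteq> UNIV"
  obtains y where "y \<noteq> 0" "\<And>j. j \<in> J \<Longrightarrow> cdot (u j) y = 0"
proof -
  define A :: "complex^'n^'n" where "A = (\<chi> i k. if i \<in> J then cnj (u i $ k) else 0)"
  obtain i where "i \<notin> J" using assms by auto
  then have "row i A = 0" by (simp add: A_def row_def vec_eq_iff)
  then have "det A = 0" by (rule det_zero_row(2))
  then have "\<not> (\<exists>B. B ** A = mat 1)" using invertible_det_nz invertible_left_inverse by metis
  then obtain y where y: "A *v y = 0" "y \<noteq> 0" using matrix_left_invertible_ker by blast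
  have "cdot (u j) y = 0" if "j \<in> J" for j
    using arg_cong[OF y(1), of "\<lambda>v. v $ j"] that
    by (simp add: A_def matrix_vector_mult_def cdot_def)
  then show thesis using that y by blast
qed

text \<open>Orthonormal eigenvectors are chosen one index at a time, each in the orthogonal
  complement of the earlier ones. They become the columns of \<open>U\<close>.\<close>

lemma hermitian_diagonalization:
  fixes H :: "complex^'n^'n"
  assumes "adj H = H"
  obtains U d where "unitary_mat U" "H = U ** diag_mat (\<lambda>i. complex_of_real (d i)) ** adj U"
proof -
  have "\<exists>u d. \<forall>i\<in>J. H *v u i = (d i :: real) *\<^sub>R u i \<and> (\<forall>j\<in>J. cdot (u i) (u j) = (if i = j then 1 else 0))"
    for J :: "'n set"
    using finite[of J]
  proof (induction J rule: finite_induct)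
    case (insert k J)
    then obtain u d where IH: "\<And>i. i \<in> J \<Longrightarrow> H *v u i = (d i :: real) *\<^sub>R u i"
      "\<And>i j. i \<in> J \<Longrightarrow> j \<in> J \<Longrightarrow> cdot (u i) (u j) = (if i = j then 1 else 0)" by metis
    have "J \<noteq> UNIV" using insert.hyps by auto
    then obtain y where y: "y \<noteq> 0" "\<And>j. j \<in> J \<Longrightarrow> cdot (u j) y = 0"
      using exists_orthogonal_nonzero[of J u] by blast
    obtain x l where xl: "norm x = 1" "\<And>j. j \<in> J \<Longrightarrow> cdot (u j) x = 0" "H *v x = l *\<^sub>R x"
      by (rule hermitian_eigenvector_orthogonal[OF assms IH(1) y]) auto
    have "cdot x (u j) = 0" if "j \<in> J" for j using xl(2)[OF that] cdot_commute[of x "u j"] by simp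
    moreover have "cdot x x = 1" using xl(1) by (simp add: cdot_self)
    ultimately show ?case
      using IH xl insert.hyps(2) by (intro exI[of _ "u(k := x)"] exI[of _ "d(k := l)"]) auto
  qed auto
  from this[of UNIV] obtain u :: "'n \<Rightarrow> complex^'n" and d where
    "\<forall>i. H *v u i = (d i :: real) *\<^sub>R u i \<and> (\<forall>j. cdot (u i) (u j) = (if i = j then 1 else 0))"
    by auto
  then have ud: "\<And>i. H *v u i = d i *\<^sub>R u i"
    "\<And>i j. cdot (u i) (u j) = (if i = j then 1 else 0)" by blast+
  define U where "U = (\<chi> i j. u j $ i)"
  have "adj U ** U = mat 1"
    using ud(2) by (simp add: vec_eq_iff matrix_matrix_mult_def adj_def U_def mat_def cdot_def)
  then have U: "unitary_mat U" using matrix_left_right_inverse by (auto simp: unitary_mat_def)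
  have "(H ** U) $ i $ j = (U ** diag_mat (\<lambda>i. complex_of_real (d i))) $ i $ j" for i j
    using arg_cong[OF ud(1)[of j], of "\<lambda>v. v $ i"]
    unfolding mat_diag_mult
    by (simp add: U_def matrix_vector_mult_def matrix_matrix_mult_def) (simp add: scaleR_conv_of_real mult.commute)
  then have "H ** U = U ** diag_mat (\<lambda>i. complex_of_real (d i))" by (simp add: vec_eq_iff)
  then have "H = U ** diag_mat (\<lambda>i. complex_of_real (d i)) ** adj U"
    using U by (metis matrix_mul_assoc matrix_mul_rid unitary_mat_def)
  then show thesis using that U by blast
qed

text \<open>The eigenvalue \<open>d i\<close> is the value of the quadratic form at the
  \<open>i\<close>-th column of \<open>U\<close>, which is nonzero.\<close>

lemma strictly_positive_diagonalization:
  fixes H :: "complex^'n^'n"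
  assumes "strictly_positive H"
  obtains U d where "unitary_mat U" "\<And>i. 0 < d i"
    "H = U ** diag_mat (\<lambda>i. complex_of_real (d i)) ** adj U"
proof -
  obtain U d where U: "unitary_mat U" and H: "H = U ** diag_mat (\<lambda>i. complex_of_real (d i)) ** adj U"
    using hermitian_diagonalization assms unfolding strictly_positive_def by metis
  have "0 < d i" for i
  proof -
    have e: "adj U *v (U *v axis i 1) = axis i 1"
      using U by (simp add: matrix_vector_mul_assoc unitary_mat_def)
    then have "U *v axis i 1 \<noteq> 0" by (metis axis_eq_0_iff matrix_vector_mult_0_right zero_neq_one)
    then have "0 < Re (cdot (U *v axis i 1) (H *v (U *v axis i 1)))"
      using assms by (simp add: strictly_positive_def)
    also have "cdot (U *v axis i 1) (H *v (U *v axis i 1))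
      = cdot (axis i 1) (diag_mat (\<lambda>i. complex_of_real (d i)) *v axis i 1)"
      unfolding H matrix_vector_mul_assoc[symmetric] e by (simp add: cdot_adj e)
    also have "\<dots> = complex_of_real (d i)"
      by (simp add: cdot_def diag_mat_vec axis_def if_distrib cong: if_cong)
    finally show ?thesis by simp
  qed
  then show thesis using that U H by blast
qed

section \<open>Partial trace\<close>

lemma adj_kron: "adj (kron A B) = kron (adj A) (adj B)"
  by (simp add: vec_eq_iff kron_def adj_def)

lemma kron_mult: "kron A B ** kron C D = kron (A ** C) (B ** D)"
  by (simp add: vec_eq_iff kron_def matrix_matrix_mult_def sum_product UNIV_Times_UNIV[symmetric]
      sum.cartesian_product mult_ac del: UNIV_Times_UNIV) (simp add: case_prod_unfold)

lemma sum_UNIV_prod: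
  "(\<Sum>r\<in>(UNIV::('a::finite \<times> 'b::finite) set). g r) = (\<Sum>i\<in>UNIV. \<Sum>j\<in>UNIV. g (i, j))"
  by (simp add: sum.cartesian_product case_prod_unfold)

lemma if_zero_mult:
  fixes a b :: complex
  shows "(if P then a else 0) * b = (if P then a * b else 0)"
    and "a * (if P then b else 0) = (if P then a * b else 0)"
  by simp_all

text \<open>The duality between the partial trace and the embedding
  \<open>X \<mapsto> X \<otimes> 1\<close>, which carries the whole comparison between the composite
  and the reduced system.\<close>

lemma trace_kron_mult:
  fixes X :: "complex^'a^'a" and R :: "complex^('a::finite \<times> 'b::finite)^('a \<times> 'b)"
  shows "trace (kron X (mat 1) ** R) = trace (X ** ptrace_B R)"
proof -
  have "trace (kron X (mat 1) ** R)
      = (\<Sum>i\<in>UNIV. \<Sum>k\<in>UNIV. \<Sum>j\<in>UNIV. \<Sum>l\<in>UNIV. if k = l then X $ i $ j * R $ (j, l) $ (i, k) else 0)"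
    unfolding trace_def matrix_matrix_mult_def sum_UNIV_prod
    by (simp add: sum_UNIV_prod kron_def mat_def if_zero_mult)
  also have "\<dots> = (\<Sum>i\<in>UNIV. \<Sum>k\<in>UNIV. \<Sum>j\<in>UNIV. X $ i $ j * R $ (j, k) $ (i, k))"
    by simp
  also have "\<dots> = (\<Sum>i\<in>UNIV. \<Sum>j\<in>UNIV. \<Sum>k\<in>UNIV. X $ i $ j * R $ (j, k) $ (i, k))"
    by (rule sum.cong[OF refl], rule sum.swap)
  also have "\<dots> = trace (X ** ptrace_B R)"
    by (simp add: trace_def matrix_matrix_mult_def ptrace_B_def sum_distrib_left)
  finally show ?thesis .
qed

lemma trace_ptrace_B: "trace (ptrace_B R) = trace R"
  by (simp add: trace_def ptrace_B_def sum_UNIV_prod)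

text \<open>The form of the reduced matrix at \<open>x\<close> is the sum over \<open>k\<close> of
  the form of \<open>R\<close> at \<open>e k\<close>, the tensor product of \<open>x\<close> with
  the \<open>k\<close>-th basis vector of the second factor.\<close>

lemma strictly_positive_ptrace_B:
  fixes R :: "complex^('a::finite \<times> 'b::finite)^('a \<times> 'b)"
  assumes "strictly_positive R"
  shows "strictly_positive (ptrace_B R)"
  unfolding strictly_positive_def
proof (intro conjI allI impI)
  have "adj R $ p $ q = R $ p $ q" for p q using assms by (simp add: strictly_positive_def)
  then have "cnj (R $ q $ p) = R $ p $ q" for p q by (simp add: adj_def)
  then show "adj (ptrace_B R) = ptrace_B R"
    by (simp add: vec_eq_iff adj_def ptrace_B_def)
next
  fix x :: "complex^'a" assume "x \<noteq> 0"
  define e :: "'b \<Rightarrow> complex^('a \<times> 'b)" where "e k = (\<chi> p. if snd p = k then x $ fst p else 0)" for k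
  have "e k \<noteq> 0" for k
  proof -
    obtain i where "x $ i \<noteq> 0" using \<open>x \<noteq> 0\<close> by (auto simp: vec_eq_iff)
    then have "e k $ (i, k) \<noteq> 0" by (simp add: e_def)
    then show ?thesis by auto
  qed
  then have pos: "0 < (\<Sum>k\<in>UNIV. Re (cdot (e k) (R *v e k)))"
    using assms by (intro sum_pos) (auto simp: strictly_positive_def)
  have "cdot (e k) (R *v e k) = (\<Sum>i\<in>UNIV. \<Sum>j\<in>UNIV. cnj (x $ i) * (R $ (i, k) $ (j, k) * x $ j))" for k
    unfolding cdot_def matrix_vector_mult_def sum_UNIV_prod
    by (simp add: sum_UNIV_prod e_def if_distrib[of cnj] if_zero_mult cong: if_cong)
      (simp add: sum_distrib_left)
  then have "(\<Sum>k\<in>UNIV. cdot (e k) (R *v e k))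
      = (\<Sum>k\<in>UNIV. \<Sum>i\<in>UNIV. \<Sum>j\<in>UNIV. cnj (x $ i) * (R $ (i, k) $ (j, k) * x $ j))" by simp
  also have "\<dots> = (\<Sum>i\<in>UNIV. \<Sum>j\<in>UNIV. \<Sum>k\<in>UNIV. cnj (x $ i) * (R $ (i, k) $ (j, k) * x $ j))"
    by (subst sum.swap, rule sum.cong[OF refl], rule sum.swap)
  also have "\<dots> = cdot x (ptrace_B R *v x)"
    by (simp add: cdot_def matrix_vector_mult_def ptrace_B_def sum_distrib_left sum_distrib_right)
  finally show "0 < Re (cdot x (ptrace_B R *v x))" using pos by (metis Re_sum)
qed

section \<open>The spectral measure of the relative modular operator\<close>

text \<open>The concave functional \<open>X \<mapsto> 2 Re \<langle>X, \<rho>\<rangle> - \<langle>X, \<sigma> X + s X \<rho>\<rangle>\<close> in the Hilbert--Schmidt inner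
  product; its maximum is \<open>\<langle>\<rho>, L\<inverse> \<rho>\<rangle>\<close> with \<open>L X = \<sigma> X + s X \<rho>\<close>.\<close>

definition resolvent_functional ::
  "complex^'n^'n \<Rightarrow> complex^'n^'n \<Rightarrow> real \<Rightarrow> complex^'n^'n \<Rightarrow> real" where
  "resolvent_functional \<rho> \<sigma> s X =
     2 * Re (trace (adj X ** \<rho>)) - Re (trace (adj X ** \<sigma> ** X)) - s * Re (trace (X ** \<rho> ** adj X))"

text \<open>Cyclicity of the trace brings every term to the form of the trace of
  \<open>(Z \<otimes> 1) ** R\<close> with \<open>R\<close> one of \<open>\<rho>\<close>,
  \<open>\<sigma>\<close>, where the duality with the partial trace applies.\<close>

lemma resolvent_functional_kron:
  fixes \<rho> \<sigma> :: "complex^('a::finite \<times> 'b::finite)^('a \<times> 'b)"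
  shows "resolvent_functional \<rho> \<sigma> s (kron X (mat 1)) = resolvent_functional (ptrace_B \<rho>) (ptrace_B \<sigma>) s X"
proof -
  have adj1: "adj (mat 1) = (mat 1 :: complex^'b^'b)"
    by (auto simp: adj_def mat_def vec_eq_iff)
  have cyc1: "trace (adj Y ** S ** Y) = trace (Y ** adj Y ** S)" for Y S :: "complex^'c^'c"
    by (metis trace_mul_sym matrix_mul_assoc)
  have cyc2: "trace (Y ** R ** adj Y) = trace (adj Y ** Y ** R)" for Y R :: "complex^'c^'c"
    by (metis trace_mul_sym matrix_mul_assoc)
  show ?thesis
    unfolding resolvent_functional_def cyc1 cyc2
    by (simp add: adj_kron adj1 kron_mult trace_kron_mult)
qed

lemma trace_adj_mult: "trace (adj Y ** Z) = (\<Sum>i\<in>UNIV. \<Sum>j\<in>UNIV. cnj (Y $ j $ i) * Z $ j $ i)"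
  by (simp add: trace_def matrix_matrix_mult_def adj_def)

text \<open>Left multiplication by \<open>\<sigma>\<close> and right multiplication by
  \<open>\<rho>\<close> are simultaneously diagonal in the basis formed from both eigenbases. The
  functional therefore splits into independent scalar quadratics in the entries of
  \<open>Y\<close>.\<close>

lemma resolvent_functional_diag:
  fixes U V Y :: "complex^'n^'n"
  assumes U: "unitary_mat U" and V: "unitary_mat V"
  defines "W \<equiv> adj V ** U"
  shows "resolvent_functional (U ** diag_mat (\<lambda>i. complex_of_real (p i)) ** adj U)
            (V ** diag_mat (\<lambda>j. complex_of_real (q j)) ** adj V) s (V ** Y ** adj U)
       = (\<Sum>i\<in>UNIV. \<Sum>j\<in>UNIV. 2 * Re (cnj (Y $ j $ i) * (p i * W $ j $ i)) - (q j + s * p i) * (cmod (Y $ j $ i))\<^sup>2)"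
proof -
  let ?P = "diag_mat (\<lambda>i. complex_of_real (p i)) :: complex^'n^'n"
  let ?D = "diag_mat (\<lambda>j. complex_of_real (q j)) :: complex^'n^'n"
  let ?X = "V ** Y ** adj U"
  have cancel: "M ** adj U ** U = M" "M ** adj V ** V = M" for M :: "complex^'n^'n"
    using U V by (simp_all add: unitary_mat_def flip: matrix_mul_assoc)
  have conj: "trace (U ** M ** adj U) = trace M" "trace (V ** M ** adj V) = trace M" for M
    using U V by (metis trace_mul_sym matrix_mul_assoc matrix_mul_lid unitary_mat_def)+
  have X: "adj ?X = U ** adj Y ** adj V" by (simp add: adj_mult matrix_mul_assoc)
  have "adj ?X ** (U ** ?P ** adj U) = U ** (adj Y ** (W ** ?P)) ** adj U"
    unfolding X W_def by (simp add: matrix_mul_assoc)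
  then have t1: "trace (adj ?X ** (U ** ?P ** adj U)) = trace (adj Y ** (W ** ?P))"
    using conj(1) by metis
  have "adj ?X ** (V ** ?D ** adj V) ** ?X = U ** (adj Y ** (?D ** Y)) ** adj U"
    unfolding X by (simp add: matrix_mul_assoc cancel)
  then have t2: "trace (adj ?X ** (V ** ?D ** adj V) ** ?X) = trace (adj Y ** (?D ** Y))"
    using conj(1) by metis
  have "?X ** (U ** ?P ** adj U) ** adj ?X = V ** (Y ** ?P ** adj Y) ** adj V"
    unfolding X by (simp add: matrix_mul_assoc cancel)
  then have t3: "trace (?X ** (U ** ?P ** adj U) ** adj ?X) = trace (adj Y ** (Y ** ?P))"
    using conj(2) trace_mul_sym by metis
  show ?thesis
    unfolding resolvent_functional_def t1 t2 t3
    unfolding trace_adj_mult mat_diag_mult diag_mat_mult Re_sum sum_distrib_left sum_subtractf[symmetric]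
    by (intro sum.cong refl) (simp add: cmod_power2, simp add: algebra_simps power2_eq_square)
qed

text \<open>Completing the square; the maximizer is \<open>z / a\<close>.\<close>

lemma quadratic_maximum:
  fixes y z :: complex and a :: real
  assumes "0 < a"
  shows "2 * Re (cnj y * z) - a * (cmod y)\<^sup>2 \<le> (cmod z)\<^sup>2 / a"
    and "2 * Re (cnj (z / a) * z) - a * (cmod (z / a))\<^sup>2 = (cmod z)\<^sup>2 / a"
proof -
  have *: "2 * Re (cnj y * z) - a * (cmod y)\<^sup>2 = (cmod z)\<^sup>2 / a - (cmod (a * y - z))\<^sup>2 / a" for y :: complex
    using assms by (simp add: cmod_power2, simp add: field_simps power2_eq_square)
  show "2 * Re (cnj y * z) - a * (cmod y)\<^sup>2 \<le> (cmod z)\<^sup>2 / a"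
    unfolding * using assms by simp
  show "2 * Re (cnj (z / a) * z) - a * (cmod (z / a))\<^sup>2 = (cmod z)\<^sup>2 / a"
    unfolding * using assms by simp
qed

text \<open>The pairs \<open>x\<close>, \<open>w\<close> are the nodes and masses of the measure
  \<open>\<mu>\<close>. Four conclusions express the entropy, the traces, the total mass and the
  Stieltjes transform through it; the last one is stated as an attained maximum so that trial
  matrices can be transferred between systems.\<close>

lemma spectral_measure:
  fixes \<rho> \<sigma> :: "complex^'n^'n"
  assumes "strictly_positive \<rho>" "strictly_positive \<sigma>"
  obtains x w :: "'n \<times> 'n \<Rightarrow> real" where
    "\<And>r. 0 < x r"
    "\<And>f. f_rel_entropy f \<rho> \<sigma> = complex_of_real (\<Sum>r\<in>UNIV. w r * f (x r))"
    "\<And>z. trace (mat_cpow \<sigma> z ** mat_cpow \<rho> (1 - z)) = (\<Sum>r\<in>UNIV. w r *\<^sub>R exp (z * ln (x r)))"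
    "trace \<rho> = complex_of_real (\<Sum>r\<in>UNIV. w r)"
    "\<And>s. 0 < s \<Longrightarrow> (\<forall>X. resolvent_functional \<rho> \<sigma> s X \<le> (\<Sum>r\<in>UNIV. w r / (x r + s)))
      \<and> (\<exists>X. resolvent_functional \<rho> \<sigma> s X = (\<Sum>r\<in>UNIV. w r / (x r + s)))"
proof -
  obtain U p where U: "unitary_mat U" and p: "\<And>i. 0 < p i"
    and \<rho>: "\<rho> = U ** diag_mat (\<lambda>i. complex_of_real (p i)) ** adj U"
    using strictly_positive_diagonalization[OF assms(1)] by blast
  obtain V q where V: "unitary_mat V" and q: "\<And>i. 0 < q i"
    and \<sigma>: "\<sigma> = V ** diag_mat (\<lambda>i. complex_of_real (q i)) ** adj V"
    using strictly_positive_diagonalization[OF assms(2)] by blast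
  define W where "W = adj V ** U"
  define w where "w r = p (fst r) * (cmod (W $ snd r $ fst r))\<^sup>2" for r
  define x where "x r = q (snd r) / p (fst r)" for r
  \<comment> \<open>Leaving both diagonals arbitrary lets one computation serve the complex powers
    and, with \<open>b\<close> constantly 1, the total mass.\<close>
  have trace_powr: "trace (V ** diag_mat b ** adj V ** (U ** diag_mat a ** adj U))
      = (\<Sum>i\<in>UNIV. \<Sum>j\<in>UNIV. (cmod (W $ j $ i))\<^sup>2 *\<^sub>R (b j * a i))" for a b
  proof -
    have "trace (V ** diag_mat b ** adj V ** (U ** diag_mat a ** adj U))
        = trace (adj U ** (V ** diag_mat b ** adj V ** (U ** diag_mat a)))"
      by (metis trace_mul_sym matrix_mul_assoc)
    also have "adj U ** (V ** diag_mat b ** adj V ** (U ** diag_mat a))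
        = adj W ** (diag_mat b ** (W ** diag_mat a))"
      by (simp add: W_def adj_mult matrix_mul_assoc)
    finally show ?thesis
      unfolding trace_adj_mult diag_mat_mult mat_diag_mult
      by (simp add: scaleR_conv_of_real complex_norm_square mult_ac del: of_real_power)
  qed
  \<comment> \<open>Multiplying numerator and denominator by \<open>p i\<close> gives the maximum of
    a scalar quadratic with \<open>z = p i * W $ j $ i\<close> and
    \<open>a = q j + s * p i\<close>.\<close>
  have resolvent: "w (i, j) / (x (i, j) + s) = (cmod (p i * W $ j $ i))\<^sup>2 / (q j + s * p i)"
    and denom: "0 < q j + s * p i" if "0 < s" for i j s
    using p[of i] q[of j] that
    by (auto simp: w_def x_def norm_mult power_mult_distrib field_simps power2_eq_square add_pos_pos)
  show thesis
  proof (rule that[of x w])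
    show "0 < x r" for r using p q by (simp add: x_def)
    show "f_rel_entropy f \<rho> \<sigma> = complex_of_real (\<Sum>r\<in>UNIV. w r * f (x r))" for f
      unfolding \<rho> \<sigma> f_rel_entropy_spectral[OF U V p] sum_UNIV_prod
      by (simp add: w_def x_def W_def mult_ac)
    show "trace (mat_cpow \<sigma> z ** mat_cpow \<rho> (1 - z)) = (\<Sum>r\<in>UNIV. w r *\<^sub>R exp (z * ln (x r)))" for z
    proof -
      have "complex_of_real (q j) powr z * complex_of_real (p i) powr (1 - z)
          = p i *\<^sub>R exp (z * ln (q j / p i))" for i j
      proof -
        have "complex_of_real (q j) powr z * complex_of_real (p i) powr (1 - z)
            = exp (complex_of_real (ln (p i)) + z * ln (q j / p i))"
          using p[of i] q[of j]
          by (simp add: powr_def Ln_of_real ln_div algebra_simps flip: exp_add)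
        also have "\<dots> = p i *\<^sub>R exp (z * ln (q j / p i))"
          using p[of i] by (simp add: exp_add exp_of_real scaleR_conv_of_real)
        finally show ?thesis .
      qed
      then show ?thesis
        unfolding \<rho> \<sigma> mat_cpow_diag[OF U p] mat_cpow_diag[OF V q] trace_powr sum_UNIV_prod
        by (simp add: w_def x_def mult_ac)
    qed
    show "trace \<rho> = complex_of_real (\<Sum>r\<in>UNIV. w r)"
    proof -
      have "diag_mat (\<lambda>_. 1) = (mat 1 :: complex^'n^'n)" by (simp add: diag_mat_def mat_def)
      then have "trace \<rho> = trace (V ** diag_mat (\<lambda>_. 1) ** adj V ** \<rho>)"
        using V by (simp add: unitary_mat_def)
      also have "\<dots> = complex_of_real (\<Sum>r\<in>UNIV. w r)"
        unfolding \<rho> trace_powr sum_UNIV_prod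
        by (simp add: w_def scaleR_conv_of_real mult_ac)
      finally show ?thesis .
    qed
  next
    fix s :: real assume s: "0 < s"
    have "resolvent_functional \<rho> \<sigma> s X \<le> (\<Sum>r\<in>UNIV. w r / (x r + s))" for X
    proof -
      \<comment> \<open>Every \<open>X\<close> has the form \<open>V ** Y ** adj U\<close>, so the
        bound holds entry by entry in \<open>Y\<close>.\<close>
      have "X = (V ** adj V) ** X ** (U ** adj U)" using U V by (simp add: unitary_mat_def)
      then have X: "X = V ** (adj V ** X ** U) ** adj U" by (simp add: matrix_mul_assoc)
      show ?thesis
        unfolding sum_UNIV_prod
        by (subst X, unfold \<rho> \<sigma> resolvent_functional_diag[OF U V] resolvent[OF s])
          (unfold W_def, intro sum_mono quadratic_maximum(1)[OF denom[OF s]])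
    qed
    \<comment> \<open>The entrywise maximizers \<open>z / a\<close> assembled into one
      matrix.\<close>
    moreover define Y :: "complex^'n^'n" where "Y = (\<chi> j i. p i * W $ j $ i / complex_of_real (q j + s * p i))"
    have "resolvent_functional \<rho> \<sigma> s (V ** Y ** adj U) = (\<Sum>r\<in>UNIV. w r / (x r + s))"
      unfolding sum_UNIV_prod \<rho> \<sigma> resolvent_functional_diag[OF U V] resolvent[OF s]
      unfolding Y_def vec_lambda_beta W_def
      by (intro sum.cong refl quadratic_maximum(2)[OF denom[OF s]])
    ultimately show "(\<forall>X. resolvent_functional \<rho> \<sigma> s X \<le> (\<Sum>r\<in>UNIV. w r / (x r + s)))
      \<and> (\<exists>X. resolvent_functional \<rho> \<sigma> s X = (\<Sum>r\<in>UNIV. w r / (x r + s)))" by blast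
  qed
qed

section \<open>Comparison of the spectral measures of the composite and the reduced pair\<close>

theorem corollary1:
  fixes \<rho> \<sigma> :: "complex^('a::finite \<times> 'b::finite)^('a \<times> 'b)"
    and f :: "real \<Rightarrow> real"
  assumes "f = (\<lambda>t. - ln t)"
    and "strictly_positive \<rho>" and "strictly_positive \<sigma>"
  shows "f_rel_entropy f \<rho> \<sigma> = f_rel_entropy f (ptrace_B \<rho>) (ptrace_B \<sigma>) \<longleftrightarrow>
    (\<forall>t::complex. trace (mat_cpow \<sigma> (\<i> * t) ** mat_cpow \<rho> (- \<i> * t + 1))
                = trace (mat_cpow (ptrace_B \<sigma>) (\<i> * t) ** mat_cpow (ptrace_B \<rho>) (- \<i> * t + 1)))"
proof -
  obtain x w :: "('a \<times> 'b) \<times> 'a \<times> 'b \<Rightarrow> real" where x: "\<And>r. 0 < x r"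
    and entropy: "\<And>f. f_rel_entropy f \<rho> \<sigma> = complex_of_real (\<Sum>r\<in>UNIV. w r * f (x r))"
    and tr_powr: "\<And>z. trace (mat_cpow \<sigma> z ** mat_cpow \<rho> (1 - z)) = (\<Sum>r\<in>UNIV. w r *\<^sub>R exp (z * ln (x r)))"
    and tr: "trace \<rho> = complex_of_real (\<Sum>r\<in>UNIV. w r)"
    and max: "\<And>s. 0 < s \<Longrightarrow> (\<forall>X. resolvent_functional \<rho> \<sigma> s X \<le> (\<Sum>r\<in>UNIV. w r / (x r + s)))
      \<and> (\<exists>X. resolvent_functional \<rho> \<sigma> s X = (\<Sum>r\<in>UNIV. w r / (x r + s)))"
    using spectral_measure[OF assms(2,3)] by blast
  obtain y v :: "'a \<times> 'a \<Rightarrow> real" where y: "\<And>r. 0 < y r"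
    and entropy': "\<And>f. f_rel_entropy f (ptrace_B \<rho>) (ptrace_B \<sigma>) = complex_of_real (\<Sum>r\<in>UNIV. v r * f (y r))"
    and tr_powr': "\<And>z. trace (mat_cpow (ptrace_B \<sigma>) z ** mat_cpow (ptrace_B \<rho>) (1 - z))
      = (\<Sum>r\<in>UNIV. v r *\<^sub>R exp (z * ln (y r)))"
    and tr': "trace (ptrace_B \<rho>) = complex_of_real (\<Sum>r\<in>UNIV. v r)"
    and max': "\<And>s. 0 < s \<Longrightarrow>
      (\<forall>X. resolvent_functional (ptrace_B \<rho>) (ptrace_B \<sigma>) s X \<le> (\<Sum>r\<in>UNIV. v r / (y r + s)))
      \<and> (\<exists>X. resolvent_functional (ptrace_B \<rho>) (ptrace_B \<sigma>) s X = (\<Sum>r\<in>UNIV. v r / (y r + s)))"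
    using spectral_measure[OF assms(2,3)[THEN strictly_positive_ptrace_B]] by blast
  \<comment> \<open>The difference of the two measures, as one signed measure on the disjoint union
    of the index sets.\<close>
  define K where "K = (UNIV :: (('a \<times> 'b) \<times> 'a \<times> 'b) set) <+> (UNIV :: ('a \<times> 'a) set)"
  define c where "c = case_sum w (\<lambda>r. - v r)"
  define u where "u = case_sum x y"
  have K: "finite K" by (simp add: K_def)
  have u: "0 < u k" for k using x y by (simp add: u_def split: sum.split)
  have diff: "(\<Sum>k\<in>K. c k *\<^sub>R h (u k)) = (\<Sum>r\<in>UNIV. w r *\<^sub>R h (x r)) - (\<Sum>r\<in>UNIV. v r *\<^sub>R h (y r))"
    for h :: "real \<Rightarrow> 'v::real_vector"
    unfolding K_def by (subst sum.Plus) (simp_all add: c_def u_def sum_negf)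
  have diff_iff: "(\<Sum>k\<in>K. c k *\<^sub>R h (u k)) = 0
      \<longleftrightarrow> (\<Sum>r\<in>UNIV. w r *\<^sub>R h (x r)) = (\<Sum>r\<in>UNIV. v r *\<^sub>R h (y r))"
    for h :: "real \<Rightarrow> 'v::real_vector"
    unfolding diff by simp
  have entropy_iff: "f_rel_entropy f \<rho> \<sigma> = f_rel_entropy f (ptrace_B \<rho>) (ptrace_B \<sigma>)
      \<longleftrightarrow> (\<Sum>k\<in>K. c k * ln (u k)) = 0"
    unfolding entropy entropy' assms(1) of_real_eq_iff using diff_iff[of ln] by (simp add: sum_negf)
  have trace_iff: "trace (mat_cpow \<sigma> z ** mat_cpow \<rho> (1 - z))
        = trace (mat_cpow (ptrace_B \<sigma>) z ** mat_cpow (ptrace_B \<rho>) (1 - z))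
      \<longleftrightarrow> (\<Sum>k\<in>K. c k *\<^sub>R exp (z * complex_of_real (ln (u k)))) = 0" for z
    unfolding tr_powr tr_powr' by (rule diff_iff[of "\<lambda>l. exp (z * complex_of_real (ln l))", symmetric])
  have powr_eq: "- \<i> * t + 1 = 1 - \<i> * t" for t by simp
  show ?thesis
    unfolding powr_eq entropy_iff trace_iff
  proof (intro iffI allI)
    fix t
    assume ln: "(\<Sum>k\<in>K. c k * ln (u k)) = 0"
    \<comment> \<open>A maximizer \<open>X\<close> for the reduced pair gives the trial matrix
      \<open>X \<otimes> 1\<close> with the same value for the full pair, which is at most the full
      maximum.\<close>
    have nonneg: "0 \<le> (\<Sum>k\<in>K. c k / (u k + s))" if s: "0 < s" for s
    proof -
      obtain X where "resolvent_functional (ptrace_B \<rho>) (ptrace_B \<sigma>) s X = (\<Sum>r\<in>UNIV. v r / (y r + s))"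
        using max'[OF s] by blast
      then have "(\<Sum>r\<in>UNIV. v r / (y r + s)) \<le> (\<Sum>r\<in>UNIV. w r / (x r + s))"
        using max[OF s] by (metis resolvent_functional_kron)
      then show ?thesis using diff[of "\<lambda>l. 1 / (l + s)"] by simp
    qed
    \<comment> \<open>The total masses agree because the partial trace preserves the trace.\<close>
    have "(\<Sum>k\<in>K. c k) = 0" using diff[of "\<lambda>_. 1 :: real"] tr tr' by (simp add: trace_ptrace_B del: of_real_sum)
    then have "(\<Sum>k\<in>K. c k / (u k + s)) = 0" if "0 < s" for s
      using Stieltjes_transform_zero[OF K u nonneg _ ln that] by simp
    then show "(\<Sum>k\<in>K. c k *\<^sub>R exp (\<i> * t * complex_of_real (ln (u k)))) = 0"
      by (rule Stieltjes_transform_zero_imp_zero[OF K u])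
  next
    \<comment> \<open>The sum vanishes for all \<open>t\<close>, hence so does its derivative at 0,
      which is \<i> times the logarithmic sum.\<close>
    assume "\<forall>t. (\<Sum>k\<in>K. c k *\<^sub>R exp (\<i> * t * complex_of_real (ln (u k)))) = 0"
    then have "((\<lambda>t. \<Sum>k\<in>K. c k *\<^sub>R exp (\<i> * t * complex_of_real (ln (u k)))) has_field_derivative 0) (at 0)"
      by simp
    moreover have "((\<lambda>t. \<Sum>k\<in>K. c k *\<^sub>R exp (\<i> * t * complex_of_real (ln (u k)))) has_field_derivative
        (\<Sum>k\<in>K. complex_of_real (c k) * (\<i> * complex_of_real (ln (u k))))) (at 0)"
      unfolding scaleR_conv_of_real by (rule derivative_eq_intros refl)+ (simp add: mult_ac)
    ultimately have "0 = (\<Sum>k\<in>K. complex_of_real (c k) * (\<i> * complex_of_real (ln (u k))))"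
      by (rule DERIV_unique)
    also have "\<dots> = \<i> * complex_of_real (\<Sum>k\<in>K. c k * ln (u k))"
      by (simp add: sum_distrib_left mult_ac)
    finally show "(\<Sum>k\<in>K. c k * ln (u k)) = 0" by (simp del: of_real_sum)
  qed
qed

end
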